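(* Let $\mathcal{H}$ be a separable real Hilbert space and let $\rho\colon\mathcal{H}\to(0,\infty)$ be lower semicontinuous, that is, all level sets $\mathcal{H}(t)=\{x\in\mathcal{H}:\rho(x)>t\}$, $t\ge 0$, are open. Then for all $x,w\in\mathcal{H}$ and all $t\in(0,\rho(x))$, $$\mathbb{P}\bigl(\tau_{p_{x,w}^{-1}(\mathcal{H}(t))}<\infty\mid\Theta=0\bigr)=1,$$ i.e. the number of iterations of the shrinkage loop called within elliptical slice sampling is almost surely finite.
   Context: For $x,w\in\mathcal{H}$, $p_{x,w}\colon[0,2\pi)\to\mathcal{H}$, $p_{x,w}(\theta)=\cos(\theta)x+\sin(\theta)w$, with pre-image $p_{x,w}^{-1}(A)=\{\theta\in[0,2\pi):p_{x,w}(\theta)\in A\}$. Generalized intervals: for $\alpha,\beta\in[0,2\pi)$, $I(\alpha,\beta)=[\alpha,\beta)$ if $\alpha<\beta$, $I(\alpha,\beta)=[0,\beta)\cup[\alpha,2\pi)$ if $\alpha>\beta$, $I(\alpha,\alpha)=[0,2\pi)$; and $J(\alpha,\beta)=I(\alpha,\beta)$ if $\alpha\ne\beta$, $J(\alpha,\alpha)=\emptyset$. $\mathcal{U}_I$ denotes the uniform distribution on a bounded Borel set $I\subset\mathbb{R}$ of positive Lebesgue measure, and $\delta_v$ the Dirac measure at $v$. Shrinkage chain: for $\theta\in[0,2\pi)$ let $\Lambda_\theta=\{(\gamma,\gamma^{\min},\gamma^{\max})\in[0,2\pi)^3:\gamma,\theta\in I(\gamma^{\min},\gamma^{\max}),\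 \gamma\ne\theta\}$ and, for $z=(\gamma,\gamma^{\min},\gamma^{\max})\in\Lambda_\theta$ and $D\in\mathcal{B}([0,2\pi)^3)$, $$R_\theta(z,D)=\mathbf{1}_{J(\gamma^{\min},\theta)}(\gamma)\,\bigl(\mathcal{U}_{I(\gamma,\gamma^{\max})}\otimes\delta_{(\gamma,\gamma^{\max})}\bigr)(D)+\mathbf{1}_{I(\theta,\gamma^{\max})}(\gamma)\,\bigl(\mathcal{U}_{I(\gamma^{\min},\gamma)}\otimes\delta_{(\gamma^{\min},\gamma)}\bigr)(D).$$ This is a Markov kernel with $R_\theta(z,\Lambda_\theta)=1$. Let $\mathbb{P}(\cdot\mid\Theta=\theta)$ be the law under which $(Z_n)_{n\in\mathbb{N}}$, $Z_n=(\Gamma_n,\Gamma_n^{\min},\Gamma_n^{\max})$, is the Markov chain with transition kernel $R_\theta$ and initial law $\mathbb{P}_{Z_1}(D)=\int_0^{2\pi}\delta_{(\gamma,\gamma,\gamma)}(D)\frac{\mathrm{d}\gamma}{2\pi}$ (so $Z_1\in\Lambda_\theta$ almost surely). For $S\in\mathcal{B}([0,2\pi))$ let $\tau_S=\inf\{n\in\mathbb{N}:\Gamma_n\in S\}$ ($\inf\emptyset=\infty$). *)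

theory Defs
  imports "HOL-Probability.Probability"
begin

definition level_set :: "('a \<Rightarrow> real) \<Rightarrow> real \<Rightarrow> 'a set" where
  "level_set \<rho> t = {x. \<rho> x > t}"

definition ellipse :: "'a::real_vector \<Rightarrow> 'a \<Rightarrow> real \<Rightarrow> 'a" where
  "ellipse x w \<theta> = cos \<theta> *\<^sub>R x + sin \<theta> *\<^sub>R w"

definition angles :: "real set" where
  "angles = {0..<2 * pi}"

definition ellipse_preimage :: "'a::real_vector \<Rightarrow> 'a \<Rightarrow> 'a set \<Rightarrow> real set" where
  "ellipse_preimage x w A = {\<theta> \<in> angles. ellipse x w \<theta> \<in> A}"

definition gen_I :: "real \<Rightarrow> real \<Rightarrow> real set" where
  "gen_I \<alpha> \<beta> =
     (if \<alpha> < \<beta> then {\<alpha>..<\<beta>}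
      else if \<alpha> > \<beta> then {0..<\<beta>} \<union> {\<alpha>..<2 * pi}
      else {0..<2 * pi})"

definition gen_J :: "real \<Rightarrow> real \<Rightarrow> real set" where
  "gen_J \<alpha> \<beta> = (if \<alpha> \<noteq> \<beta> then gen_I \<alpha> \<beta> else {})"

text \<open>States are triples of the current angle and the lower and upper interval bounds.\<close>

definition state_space :: "(real \<times> real \<times> real) measure" where
  "state_space = restrict_space borel (angles \<times> angles \<times> angles)"

definition admissible :: "real \<Rightarrow> (real \<times> real \<times> real) set" where
  "admissible \<theta> =
     {(g, gmin, gmax). g \<in> angles \<and> gmin \<in> angles \<and> gmax \<in> angles \<and>
        g \<in> gen_I gmin gmax \<and> \<theta> \<in> gen_I gmin gmax \<and> g \<noteq> \<theta>}"

text \<open>The shrinkage kernel is only defined on admissible states; the value 0 elsewhere is a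
  dummy. The chain stays in the admissible states almost surely, so it plays no role.\<close>

definition shrinkage_kernel ::
    "real \<Rightarrow> real \<times> real \<times> real \<Rightarrow> (real \<times> real \<times> real) set \<Rightarrow> real" where
  "shrinkage_kernel \<theta> z D =
     (if z \<in> admissible \<theta> then
        (case z of (g, gmin, gmax) \<Rightarrow>
           indicator (gen_J gmin \<theta>) g *
             measure (uniform_measure lborel (gen_I g gmax) \<Otimes>\<^sub>M return borel (g, gmax)) D +
           indicator (gen_I \<theta> gmax) g *
             measure (uniform_measure lborel (gen_I gmin g) \<Otimes>\<^sub>M return borel (gmin, g)) D)
      else 0)"

definition initial_law :: "(real \<times> real \<times> real) set \<Rightarrow> real" where
  "initial_law D =
     (LINT \<gamma>:{0..<2 * pi}|lborel. measure (return state_space (\<gamma>, \<gamma>, \<gamma>)) D / (2 * pi))"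

text \<open>The \<open>\<sigma>\<close>-algebra generated by \<open>Z 1, \<dots>, Z n\<close>.\<close>

definition history :: "'b measure \<Rightarrow> 's measure \<Rightarrow> (nat \<Rightarrow> 'b \<Rightarrow> 's) \<Rightarrow> nat \<Rightarrow> 'b measure" where
  "history M S Z n =
     vimage_algebra (space M) (\<lambda>\<omega>. \<lambda>i\<in>{1..n}. Z i \<omega>) (Pi\<^sub>M {1..n} (\<lambda>_. S))"

text \<open>Time starts at 1; \<open>Z 0\<close> is unconstrained. The initial law and the transition
  probabilities are given as set functions on the measurable sets of the state space.\<close>

definition markov_chain ::
    "'b measure \<Rightarrow> 's measure \<Rightarrow> ('s set \<Rightarrow> real) \<Rightarrow> ('s \<Rightarrow> 's set \<Rightarrow> real) \<Rightarrow>
     (nat \<Rightarrow> 'b \<Rightarrow> 's) \<Rightarrow> bool" where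
  "markov_chain M S \<mu> K Z \<longleftrightarrow>
     prob_space M \<and>
     (\<forall>n\<ge>1. Z n \<in> measurable M S) \<and>
     (\<forall>D\<in>sets S. measure (distr M S (Z 1)) D = \<mu> D) \<and>
     (\<forall>n\<ge>1. \<forall>D\<in>sets S. AE \<omega> in M.
        real_cond_exp M (history M S Z n) (indicator {\<omega> \<in> space M. Z (Suc n) \<omega> \<in> D}) \<omega>
          = K (Z n \<omega>) D)"

text \<open>\<open>M\<close> carries the conditional law given \<open>\<Theta> = \<theta>\<close> of the shrinkage procedure.\<close>

definition shrinkage_chain ::
    "real \<Rightarrow> 'b measure \<Rightarrow> (nat \<Rightarrow> 'b \<Rightarrow> real \<times> real \<times> real) \<Rightarrow> bool" where
  "shrinkage_chain \<theta> M Z \<longleftrightarrow>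
     markov_chain M state_space initial_law (shrinkage_kernel \<theta>) Z"

definition hitting_time ::
    "(nat \<Rightarrow> 'b \<Rightarrow> real \<times> real \<times> real) \<Rightarrow> real set \<Rightarrow> 'b \<Rightarrow> enat" where
  "hitting_time Z S \<omega> = Inf {enat n | n. n \<ge> 1 \<and> fst (Z n \<omega>) \<in> S}"

end

theory Submission
  imports Defs
begin

text \<open>Let \<open>S\<close> be an interval of accepted angles containing \<open>\<theta>\<close>. As long as the chain has not entered
  \<open>S\<close>, both bounds of the current generalized interval are rejected angles, hence outside \<open>S\<close>; as
  the generalized interval contains \<open>\<theta>\<close>, it contains all of \<open>S\<close>. The next angle is uniform on this
  subset of the circle, so each step enters \<open>S\<close> with conditional probability at least
  \<open>\<bar>S\<bar> / 2\<pi>\<close>, and the time of entry has geometric tails. The pulled back level set contains such an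
  interval for \<open>\<theta> = 0\<close>, because it is open and the ellipse passes through \<open>x\<close> at angle \<open>0\<close>.\<close>

section \<open>Markov chains\<close>

lemma measurable_history:
  assumes "\<And>n. 1 \<le> n \<Longrightarrow> Z n \<in> M \<rightarrow>\<^sub>M S" and "1 \<le> i" "i \<le> n"
  shows "Z i \<in> history M S Z n \<rightarrow>\<^sub>M S"
proof -
  let ?path = "\<lambda>\<omega>. \<lambda>i\<in>{1..n}. Z i \<omega>"
  have "?path \<in> space M \<rightarrow> space (Pi\<^sub>M {1..n} (\<lambda>_. S))"
    using measurable_space[OF assms(1)] by (auto simp: space_PiM)
  then have "?path \<in> history M S Z n \<rightarrow>\<^sub>M Pi\<^sub>M {1..n} (\<lambda>_. S)"
    unfolding history_def by (rule measurable_vimage_algebra1)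
  then have "(\<lambda>\<omega>. ?path \<omega> i) \<in> history M S Z n \<rightarrow>\<^sub>M S"
    by (rule measurable_compose[OF _ measurable_component_singleton]) (use assms(2,3) in simp)
  then show ?thesis
    using assms(2,3) by simp
qed

lemma space_history [simp]: "space (history M S Z n) = space M"
  by (simp add: history_def)

lemma subalgebra_history:
  assumes "\<And>n. 1 \<le> n \<Longrightarrow> Z n \<in> M \<rightarrow>\<^sub>M S"
  shows "subalgebra M (history M S Z n)"
proof -
  have "(\<lambda>\<omega>. \<lambda>i\<in>{1..n}. Z i \<omega>) \<in> M \<rightarrow>\<^sub>M Pi\<^sub>M {1..n} (\<lambda>_. S)"
    by (rule measurable_restrict) (use assms in auto)
  then show ?thesis
    unfolding subalgebra_def history_def
    by (simp add: sets_vimage_algebra_space sets_image_in_sets)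
qed

locale markov_process =
  fixes M :: "'b measure" and S :: "'s measure" and \<mu> :: "'s set \<Rightarrow> real"
    and K :: "'s \<Rightarrow> 's set \<Rightarrow> real" and Z :: "nat \<Rightarrow> 'b \<Rightarrow> 's"
  assumes markov_chain: "markov_chain M S \<mu> K Z"

sublocale markov_process \<subseteq> prob_space M
  using markov_chain by (simp add: markov_chain_def)

context markov_process
begin

lemma measurable_state: "1 \<le> n \<Longrightarrow> Z n \<in> M \<rightarrow>\<^sub>M S"
  using markov_chain by (simp add: markov_chain_def)

lemma state_in_space: "1 \<le> n \<Longrightarrow> \<omega> \<in> space M \<Longrightarrow> Z n \<omega> \<in> space S"
  by (rule measurable_space[OF measurable_state])

lemma state_event: "1 \<le> n \<Longrightarrow> D \<in> sets S \<Longrightarrow> {\<omega> \<in> space M. Z n \<omega> \<in> D} \<in> events"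
  by (rule predE[OF pred_sets2[OF _ measurable_state]])

lemma state_event_history:
  "1 \<le> i \<Longrightarrow> i \<le> n \<Longrightarrow> D \<in> sets S \<Longrightarrow> {\<omega> \<in> space M. Z i \<omega> \<in> D} \<in> sets (history M S Z n)"
  using predE[OF pred_sets2[OF _ measurable_history[OF measurable_state]]] by simp

lemma history_subset_events: "sets (history M S Z n) \<subseteq> events"
  using subalgebra_history[OF measurable_state] by (simp add: subalgebra_def)

lemma prob_initial:
  assumes "D \<in> sets S"
  shows "\<P>(\<omega> in M. Z 1 \<omega> \<in> D) = \<mu> D"
proof -
  have "\<P>(\<omega> in M. Z 1 \<omega> \<in> D) = measure (distr M S (Z 1)) D"
    using assms measurable_state
    by (subst measure_distr) (auto intro: arg_cong[where f = prob])
  then show ?thesis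
    using markov_chain assms by (simp add: markov_chain_def)
qed

lemma prob_next_le:
  assumes n: "1 \<le> n" and D_sets: "D \<in> sets S" and B_past: "B \<in> sets (history M S Z n)"
    and kernel_le: "\<And>\<omega>. \<omega> \<in> B \<Longrightarrow> K (Z n \<omega>) D \<le> c"
  shows "prob (B \<inter> {\<omega> \<in> space M. Z (Suc n) \<omega> \<in> D}) \<le> c * prob B"
proof -
  let ?F = "history M S Z n" and ?E = "{\<omega> \<in> space M. Z (Suc n) \<omega> \<in> D}"
  let ?cond = "real_cond_exp M ?F (indicator ?E)"
  interpret finite_measure_subalgebra M ?F
    by unfold_locales (rule subalgebra_history[OF measurable_state])
  have B_event: "B \<in> events"
    using B_past history_subset_events by blast
  have E_event: "?E \<in> events"
    using D_sets by (intro state_event) simp_all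
  have integrable_E: "integrable M (indicator ?E :: _ \<Rightarrow> real)"
    using E_event by (simp add: integrable_indicator_iff emeasure_eq_measure)
  have cond_eq: "AE \<omega> in M. ?cond \<omega> = K (Z n \<omega>) D"
    using markov_chain n D_sets by (simp add: markov_chain_def)
  have "prob (B \<inter> ?E) = (\<integral>\<omega>\<in>B. indicator ?E \<omega> \<partial>M)"
    using B_event E_event
    by (simp add: set_lebesgue_integral_def indicator_inter_arith[symmetric])
  also have "\<dots> = (\<integral>\<omega>\<in>B. ?cond \<omega> \<partial>M)"
    by (rule real_cond_exp_intA[OF integrable_E B_past])
  also have "\<dots> \<le> (\<integral>\<omega>. c * indicator B \<omega> \<partial>M)"
    unfolding set_lebesgue_integral_def
  proof (rule integral_mono_AE)
    show "integrable M (\<lambda>\<omega>. indicator B \<omega> *\<^sub>R ?cond \<omega>)"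
      by (intro integrable_mult_indicator B_event real_cond_exp_int(1) integrable_E)
    show "integrable M (\<lambda>\<omega>. c * indicator B \<omega>)"
      using B_event by (simp add: integrable_indicator_iff emeasure_eq_measure)
    show "AE \<omega> in M. indicator B \<omega> *\<^sub>R ?cond \<omega> \<le> c * indicator B \<omega>"
      using cond_eq by eventually_elim (auto simp: kernel_le split: split_indicator)
  qed
  also have "\<dots> = c * prob B"
    using B_event by simp
  finally show ?thesis .
qed

lemma stay_event_history:
  assumes "A \<in> sets S"
  shows "{\<omega> \<in> space M. \<forall>i\<in>{1..n}. Z i \<omega> \<in> A} \<in> sets (history M S Z n)"
proof -
  have "{\<omega> \<in> space (history M S Z n). \<forall>i\<in>{1..n}. Z i \<omega> \<in> A} \<in> sets (history M S Z n)"
    by (rule sets.sets_Collect_finite_All) (use assms in \<open>auto intro: state_event_history\<close>)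
  then show ?thesis
    by simp
qed

lemma prob_stay_le_power:
  assumes A_sets: "A \<in> sets S" and stay: "\<And>z. z \<in> A \<Longrightarrow> K z A \<le> c" and "0 \<le> c"
  shows "\<P>(\<omega> in M. \<forall>i\<in>{1..Suc n}. Z i \<omega> \<in> A) \<le> c ^ n"
proof (induction n)
  case 0
  show ?case
    by simp
next
  case (Suc n)
  let ?stay = "\<lambda>n. {\<omega> \<in> space M. \<forall>i\<in>{1..n}. Z i \<omega> \<in> A}"
  have "?stay (Suc (Suc n)) = ?stay (Suc n) \<inter> {\<omega> \<in> space M. Z (Suc (Suc n)) \<omega> \<in> A}"
    by (auto simp: atLeastAtMostSuc_conv)
  also have "prob \<dots> \<le> c * prob (?stay (Suc n))"
    by (rule prob_next_le[OF _ A_sets stay_event_history[OF A_sets]]) (auto intro: stay)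
  also have "\<dots> \<le> c * c ^ n"
    by (intro mult_left_mono Suc \<open>0 \<le> c\<close>)
  finally show ?case
    by simp
qed

lemma AE_leaves:
  assumes A_sets: "A \<in> sets S" and stay: "\<And>z. z \<in> A \<Longrightarrow> K z A \<le> c"
    and "0 \<le> c" "c < 1"
  shows "AE \<omega> in M. \<exists>n\<ge>1. Z n \<omega> \<notin> A"
proof -
  let ?stay = "\<lambda>n. {\<omega> \<in> space M. \<forall>i\<in>{1..n}. Z i \<omega> \<in> A}"
  have stay_event: "?stay n \<in> events" for n
    using stay_event_history[OF A_sets] history_subset_events by blast
  have "prob (\<Inter>n. ?stay n) \<le> c ^ n" for n
  proof -
    have "prob (\<Inter>n. ?stay n) \<le> prob (?stay (Suc n))"
      by (rule finite_measure_mono[OF _ stay_event]) blast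
    also have "\<dots> \<le> c ^ n"
      using A_sets stay \<open>0 \<le> c\<close> by (rule prob_stay_le_power)
    finally show ?thesis .
  qed
  then have "prob (\<Inter>n. ?stay n) \<le> 0"
    using LIMSEQ_le_const[OF LIMSEQ_realpow_zero[OF \<open>0 \<le> c\<close> \<open>c < 1\<close>]] by blast
  then have "(\<Inter>n. ?stay n) \<in> null_sets M"
    using stay_event by (auto simp: emeasure_eq_measure measure_le_0_iff)
  from AE_not_in[OF this] AE_space show ?thesis
    by eventually_elim force
qed

lemma AE_initial_not_in:
  assumes "D \<in> sets S" and "\<mu> D = 0"
  shows "AE \<omega> in M. Z 1 \<omega> \<notin> D"
  using prob_initial[OF assms(1)] assms state_event[of 1 D] by (simp add: prob_eq_0)

lemma AE_no_transition:
  assumes A_sets: "A \<in> sets S" and D_sets: "D \<in> sets S"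
    and no_transition: "\<And>z. z \<in> A \<Longrightarrow> K z D = 0"
  shows "AE \<omega> in M. \<forall>n\<ge>1. Z n \<omega> \<in> A \<longrightarrow> Z (Suc n) \<omega> \<notin> D"
  unfolding AE_all_countable
proof (intro allI AE_impI)
  fix n :: nat assume n: "1 \<le> n"
  let ?before = "{\<omega> \<in> space M. Z n \<omega> \<in> A}" and ?after = "{\<omega> \<in> space M. Z (Suc n) \<omega> \<in> D}"
  have "prob (?before \<inter> ?after) \<le> 0 * prob ?before"
    using no_transition
    by (intro prob_next_le n D_sets state_event_history[OF n order_refl A_sets]) auto
  moreover have "?before \<inter> ?after \<in> events"
    using n A_sets D_sets by (intro sets.Int state_event) auto
  ultimately have "?before \<inter> ?after \<in> null_sets M"
    by (auto simp: emeasure_eq_measure measure_le_0_iff)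
  from AE_not_in[OF this] AE_space show "AE \<omega> in M. Z n \<omega> \<in> A \<longrightarrow> Z (Suc n) \<omega> \<notin> D"
    by eventually_elim auto
qed

theorem AE_reaches:
  assumes G_sets: "G \<in> sets S" and A_sets: "A \<in> sets S"
    and initial: "\<mu> (space S - (G \<union> A)) = 0"
    and no_escape: "\<And>z. z \<in> A \<Longrightarrow> K z (space S - (G \<union> A)) = 0"
    and stay: "\<And>z. z \<in> A \<Longrightarrow> K z A \<le> c" "0 \<le> c" "c < 1"
  shows "AE \<omega> in M. \<exists>n\<ge>1. Z n \<omega> \<in> G"
proof -
  let ?N = "space S - (G \<union> A)"
  have N_sets: "?N \<in> sets S"
    using G_sets A_sets by auto
  have "AE \<omega> in M. Z 1 \<omega> \<notin> ?N"
    using N_sets initial by (rule AE_initial_not_in)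
  moreover have "AE \<omega> in M. \<forall>n\<ge>1. Z n \<omega> \<in> A \<longrightarrow> Z (Suc n) \<omega> \<notin> ?N"
    using A_sets N_sets no_escape by (rule AE_no_transition)
  moreover have "AE \<omega> in M. \<exists>n\<ge>1. Z n \<omega> \<notin> A"
    using A_sets stay by (rule AE_leaves)
  ultimately show ?thesis
    using AE_space
  proof eventually_elim
    fix \<omega>
    assume first: "Z 1 \<omega> \<notin> ?N" and step: "\<forall>n\<ge>1. Z n \<omega> \<in> A \<longrightarrow> Z (Suc n) \<omega> \<notin> ?N"
      and leaves: "\<exists>n\<ge>1. Z n \<omega> \<notin> A" and \<omega>: "\<omega> \<in> space M"
    show "\<exists>n\<ge>1. Z n \<omega> \<in> G"
    proof (rule ccontr)
      assume never: "\<not> (\<exists>n\<ge>1. Z n \<omega> \<in> G)"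
      have "Z n \<omega> \<in> A" if "1 \<le> n" for n
        using that
      proof (induction n rule: nat_induct_at_least)
        case base
        show ?case
          using never first state_in_space[OF _ \<omega>, of 1] by auto
      next
        case (Suc n)
        then show ?case
          using never step state_in_space[OF _ \<omega>, of "Suc n"] by auto
      qed
      then show False
        using leaves by blast
    qed
  qed
qed

end

section \<open>Generalized intervals\<close>

lemma mem_gen_I:
  "x \<in> gen_I a b \<longleftrightarrow>
    (if a < b then a \<le> x \<and> x < b
     else if b < a then 0 \<le> x \<and> x < b \<or> a \<le> x \<and> x < 2 * pi
     else 0 \<le> x \<and> x < 2 * pi)"
  by (auto simp: gen_I_def)

lemma gen_I_subset_angles: "a \<in> angles \<Longrightarrow> b \<in> angles \<Longrightarrow> gen_I a b \<subseteq> angles"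
  by (auto simp: gen_I_def angles_def)

lemma sets_gen_I [measurable]: "gen_I a b \<in> sets borel"
  by (simp add: gen_I_def)

lemma subset_angles_fmeasurable:
  assumes "A \<in> sets borel" and "A \<subseteq> angles"
  shows "A \<in> fmeasurable lborel" and "measure lborel A \<le> 2 * pi"
proof -
  have bound: "emeasure lborel A \<le> ennreal (2 * pi)"
    using emeasure_mono[OF assms(2), of lborel] by (simp add: angles_def)
  then show "A \<in> fmeasurable lborel"
    using assms(1) by (intro fmeasurableI) (auto intro: le_less_trans)
  show "measure lborel A \<le> 2 * pi"
    using bound by (simp add: measure_def enn2real_leI)
qed

lemma interval_subset_gen_I:
  assumes S: "is_interval S" "S \<subseteq> angles" and \<theta>: "\<theta> \<in> S" "\<theta> \<in> gen_I a b"
    and "a \<notin> S" "b \<notin> S"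
  shows "S \<subseteq> gen_I a b"
proof
  fix x assume "x \<in> S"
  have same_side: "c \<le> x \<longleftrightarrow> c \<le> \<theta>" if "c \<notin> S" for c
    using mem_is_interval_1_I[OF S(1) \<open>x \<in> S\<close> \<theta>(1), of c]
      mem_is_interval_1_I[OF S(1) \<theta>(1) \<open>x \<in> S\<close>, of c] that
    by (meson linear)
  have "a \<le> x \<longleftrightarrow> a \<le> \<theta>" and "x < b \<longleftrightarrow> \<theta> < b"
    using same_side assms(5,6) by (simp_all flip: not_le)
  moreover have "0 \<le> x" "x < 2 * pi"
    using \<open>x \<in> S\<close> S(2) by (auto simp: angles_def)
  ultimately show "x \<in> gen_I a b"
    using \<theta>(2) by (auto simp: mem_gen_I split: if_splits)
qed

section \<open>The shrinkage kernel\<close>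

lemma emeasure_pair_return:
  assumes D: "D \<in> sets (M \<Otimes>\<^sub>M L)" and y: "y \<in> space L"
  shows "emeasure (M \<Otimes>\<^sub>M return L y) D = emeasure M ((\<lambda>x. (x, y)) -` D)"
proof -
  interpret prob_space "return L y"
    using y by (rule prob_space_return)
  have "D \<in> sets (M \<Otimes>\<^sub>M return L y)"
    using D by (simp cong: sets_pair_measure_cong)
  then have "emeasure (M \<Otimes>\<^sub>M return L y) D = (\<integral>\<^sup>+x. emeasure (return L y) (Pair x -` D) \<partial>M)"
    by (rule emeasure_pair_measure_alt)
  also have "\<dots> = (\<integral>\<^sup>+x. indicator ((\<lambda>x. (x, y)) -` D) x \<partial>M)"
    by (intro nn_integral_cong) (use sets_Pair1[OF D] in \<open>simp add: indicator_def\<close>)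
  also have "\<dots> = emeasure M ((\<lambda>x. (x, y)) -` D)"
    using sets_Pair2[OF D] by simp
  finally show ?thesis .
qed

lemma measure_uniform_pair_return:
  assumes A_pos: "0 < measure M A" and D: "D \<in> sets (M \<Otimes>\<^sub>M L)" and y: "y \<in> space L"
  shows "measure (uniform_measure M A \<Otimes>\<^sub>M return L y) D
    = measure M (A \<inter> {x. (x, y) \<in> D}) / measure M A"
proof -
  have "D \<in> sets (uniform_measure M A \<Otimes>\<^sub>M L)"
    using D by (simp cong: sets_pair_measure_cong)
  then have "measure (uniform_measure M A \<Otimes>\<^sub>M return L y) D
      = measure (uniform_measure M A) ((\<lambda>x. (x, y)) -` D)"
    by (simp add: measure_def emeasure_pair_return y)
  also have "\<dots> = measure M (A \<inter> (\<lambda>x. (x, y)) -` D) / measure M A"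
  proof (rule measure_uniform_measure)
    show "emeasure M A \<noteq> 0" "emeasure M A \<noteq> \<infinity>"
      using A_pos by (auto simp: measure_def)
  qed (rule sets_Pair2[OF D])
  finally show ?thesis
    by (simp add: vimage_def)
qed

definition shrink_law :: "real \<Rightarrow> real \<Rightarrow> (real \<times> real \<times> real) measure" where
  "shrink_law a b = uniform_measure lborel (gen_I a b) \<Otimes>\<^sub>M return borel (a, b)"

lemma shrinkage_kernel_cases:
  assumes z: "(g, a, b) \<in> admissible \<theta>" and \<theta>: "\<theta> \<in> angles"
  obtains (raise) "\<theta> \<in> gen_I g b" "shrinkage_kernel \<theta> (g, a, b) = measure (shrink_law g b)"
    | (lower) "\<theta> \<in> gen_I a g" "shrinkage_kernel \<theta> (g, a, b) = measure (shrink_law a g)"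
proof (cases "g \<in> gen_J a \<theta>")
  case True
  then have "g \<notin> gen_I \<theta> b" and "\<theta> \<in> gen_I g b"
    using z \<theta> by (auto simp: admissible_def angles_def gen_J_def mem_gen_I split: if_splits)
  then show ?thesis
    using True z by (intro raise) (auto simp: shrinkage_kernel_def shrink_law_def)
next
  case False
  then have "g \<in> gen_I \<theta> b" and "\<theta> \<in> gen_I a g"
    using z \<theta> by (auto simp: admissible_def angles_def gen_J_def mem_gen_I split: if_splits)
  then show ?thesis
    using False z by (intro lower) (auto simp: shrinkage_kernel_def shrink_law_def)
qed

lemma sets_angles [measurable]: "angles \<in> sets borel"
  by (simp add: angles_def)

lemma sets_state_space_iff:
  "D \<in> sets state_space \<longleftrightarrow> D \<in> sets borel \<and> D \<subseteq> angles \<times> angles \<times> angles"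
proof -
  have "angles \<times> angles \<times> angles \<in> sets (borel :: (real \<times> real \<times> real) measure)"
    by (simp add: borel_prod[symmetric])
  then show ?thesis
    by (auto simp: state_space_def sets_restrict_space_iff)
qed

lemma space_state_space: "space state_space = angles \<times> angles \<times> angles"
  by (simp add: state_space_def space_restrict_space)

lemma admissible_subset_space: "admissible \<theta> \<subseteq> space state_space"
  by (auto simp: admissible_def space_state_space)

lemma sets_admissible: "admissible \<theta> \<in> sets state_space"
proof -
  have "admissible \<theta> = {z \<in> space (borel \<Otimes>\<^sub>M borel \<Otimes>\<^sub>M borel).
      fst z \<in> angles \<and> fst (snd z) \<in> angles \<and> snd (snd z) \<in> angles \<and>
      fst z \<in> gen_I (fst (snd z)) (snd (snd z)) \<and> \<theta> \<in> gen_I (fst (snd z)) (snd (snd z)) \<and>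
      fst z \<noteq> \<theta>}"
    by (auto simp: admissible_def space_pair_measure)
  also have "\<dots> \<in> sets (borel \<Otimes>\<^sub>M borel \<Otimes>\<^sub>M borel)"
    unfolding mem_gen_I by measurable
  finally show ?thesis
    using admissible_subset_space
    by (simp only: sets_state_space_iff borel_prod space_state_space simp_thms)
qed

lemma measure_shrink_law:
  assumes "0 < measure lborel (gen_I a b)" and "D \<in> sets state_space"
  shows "measure (shrink_law a b) D
    = measure lborel (gen_I a b \<inter> {\<gamma>. (\<gamma>, a, b) \<in> D}) / measure lborel (gen_I a b)"
proof -
  have "sets (lborel \<Otimes>\<^sub>M borel) = sets (borel :: (real \<times> real \<times> real) measure)"
    by (metis borel_prod sets_lborel sets_pair_measure_cong)
  then show ?thesis
    unfolding shrink_law_def using assms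
    by (intro measure_uniform_pair_return) (simp_all add: sets_state_space_iff)
qed

lemma initial_law_eq_0:
  assumes "D \<in> sets state_space" and "\<And>\<gamma>. \<gamma> \<in> angles \<Longrightarrow> (\<gamma>, \<gamma>, \<gamma>) \<notin> D"
  shows "initial_law D = 0"
proof -
  have "initial_law D = (LINT \<gamma>:{0..<2 * pi}|lborel. 0)"
    unfolding initial_law_def
    by (rule set_lebesgue_integral_cong) (use assms in \<open>auto simp: measure_return angles_def\<close>)
  then show ?thesis
    by simp
qed

section \<open>Entering an interval of accepted angles\<close>

locale acceptance_interval =
  fixes \<theta> :: real and S :: "real set"
  assumes interval: "is_interval S" and subset_angles: "S \<subseteq> angles"
    and contains: "\<theta> \<in> S" and measure_pos: "0 < measure lborel S"
begin

definition accepted :: "(real \<times> real \<times> real) set" where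
  "accepted = S \<times> angles \<times> angles"

definition rejected :: "(real \<times> real \<times> real) set" where
  "rejected = {(g, a, b) \<in> admissible \<theta>. g \<notin> S \<and> a \<notin> S \<and> b \<notin> S}"

abbreviation unreachable :: "(real \<times> real \<times> real) set" where
  "unreachable \<equiv> space state_space - (accepted \<union> rejected)"

lemma sets_interval [measurable]: "S \<in> sets borel"
  using interval by (rule real_interval_borel_measurable)

lemma sets_accepted: "accepted \<in> sets state_space"
  using subset_angles by (auto simp: accepted_def sets_state_space_iff borel_prod[symmetric])

lemma sets_rejected: "rejected \<in> sets state_space"
proof -
  have "rejected = admissible \<theta> \<inter> (- S) \<times> (- S) \<times> (- S)"
    by (auto simp: rejected_def)
  moreover have "(- S) \<times> (- S) \<times> (- S) \<in> sets (borel :: (real \<times> real \<times> real) measure)"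
    by (simp add: borel_prod[symmetric])
  ultimately show ?thesis
    using sets_admissible[of \<theta>] by (auto simp: sets_state_space_iff)
qed

lemma subset_gen_I:
  "\<theta> \<in> gen_I a b \<Longrightarrow> a \<notin> S \<Longrightarrow> b \<notin> S \<Longrightarrow> S \<subseteq> gen_I a b"
  using interval_subset_gen_I interval subset_angles contains by blast

lemma measure_gen_I_pos:
  assumes "a \<in> angles - S" "b \<in> angles - S" and "\<theta> \<in> gen_I a b"
  shows "0 < measure lborel (gen_I a b)"
proof -
  have "measure lborel S \<le> measure lborel (gen_I a b)"
    using assms
    by (intro measure_mono_fmeasurable subset_gen_I subset_angles_fmeasurable gen_I_subset_angles)
      auto
  then show ?thesis
    using measure_pos by simp
qed

lemma measure_shrink_law_rejected_le:
  assumes bounds: "a \<in> angles - S" "b \<in> angles - S" and \<theta>: "\<theta> \<in> gen_I a b"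
  shows "measure (shrink_law a b) rejected \<le> 1 - measure lborel S / (2 * pi)"
proof -
  let ?I = "gen_I a b"
  have I_angles: "?I \<subseteq> angles"
    using bounds by (intro gen_I_subset_angles) auto
  have I_fmeasurable: "?I \<in> fmeasurable lborel" and I_le: "measure lborel ?I \<le> 2 * pi"
    using subset_angles_fmeasurable[OF sets_gen_I I_angles] by auto
  have S_fmeasurable: "S \<in> fmeasurable lborel"
    using sets_interval subset_angles by (rule subset_angles_fmeasurable(1))
  have I_pos: "0 < measure lborel ?I"
    using assms by (rule measure_gen_I_pos)
  have "?I \<inter> {\<gamma>. (\<gamma>, a, b) \<in> rejected} = ?I - S"
    using bounds \<theta> contains I_angles by (auto simp: rejected_def admissible_def)
  then have "measure (shrink_law a b) rejected = measure lborel (?I - S) / measure lborel ?I"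
    using measure_shrink_law[OF I_pos sets_rejected] by simp
  also have "\<dots> = 1 - measure lborel S / measure lborel ?I"
    using subset_gen_I[OF \<theta>] bounds I_fmeasurable S_fmeasurable I_pos
    by (simp add: measurable_measure_Diff diff_divide_distrib fmeasurableD)
  also have "\<dots> \<le> 1 - measure lborel S / (2 * pi)"
    using I_le I_pos by (simp add: divide_left_mono)
  finally show ?thesis .
qed

lemma measure_shrink_law_unreachable:
  assumes bounds: "a \<in> angles - S" "b \<in> angles - S" and \<theta>: "\<theta> \<in> gen_I a b"
  shows "measure (shrink_law a b) unreachable = 0"
proof -
  have "gen_I a b \<inter> {\<gamma>. (\<gamma>, a, b) \<in> unreachable} = {}"
    using bounds \<theta> contains
    by (auto simp: space_state_space accepted_def rejected_def admissible_def)
  then show ?thesis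
    using measure_shrink_law[OF measure_gen_I_pos[OF assms]] sets_accepted sets_rejected by simp
qed

lemma shrinkage_kernel_rejected:
  assumes "z \<in> rejected"
  shows "shrinkage_kernel \<theta> z rejected \<le> 1 - measure lborel S / (2 * pi)"
    and "shrinkage_kernel \<theta> z unreachable = 0"
proof -
  obtain g a b where z: "z = (g, a, b)"
    by (cases z)
  then have adm: "(g, a, b) \<in> admissible \<theta>"
    and outside: "g \<in> angles - S" "a \<in> angles - S" "b \<in> angles - S"
    using assms by (auto simp: rejected_def admissible_def)
  have "\<theta> \<in> angles"
    using contains subset_angles by blast
  with adm obtain a' b' where "a' \<in> angles - S" "b' \<in> angles - S" "\<theta> \<in> gen_I a' b'"
    and "shrinkage_kernel \<theta> z = measure (shrink_law a' b')"
    using outside unfolding z by (cases rule: shrinkage_kernel_cases) blast+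
  then show "shrinkage_kernel \<theta> z rejected \<le> 1 - measure lborel S / (2 * pi)"
    and "shrinkage_kernel \<theta> z unreachable = 0"
    using measure_shrink_law_rejected_le measure_shrink_law_unreachable by simp_all
qed

lemma initial_law_unreachable: "initial_law unreachable = 0"
proof (rule initial_law_eq_0)
  fix \<gamma> assume "\<gamma> \<in> angles"
  then show "(\<gamma>, \<gamma>, \<gamma>) \<notin> unreachable"
    using contains subset_angles
    by (auto simp: accepted_def rejected_def admissible_def gen_I_def angles_def)
qed (use sets_accepted sets_rejected in auto)

theorem shrinkage_chain_AE_enters:
  assumes "shrinkage_chain \<theta> M Z"
  shows "AE \<omega> in M. \<exists>n\<ge>1. fst (Z n \<omega>) \<in> S"
proof -
  interpret markov_process M state_space initial_law "shrinkage_kernel \<theta>" Z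
    using assms by unfold_locales (simp add: shrinkage_chain_def)
  have "measure lborel S \<le> 2 * pi"
    using sets_interval subset_angles by (rule subset_angles_fmeasurable(2))
  then have "0 \<le> 1 - measure lborel S / (2 * pi)" "1 - measure lborel S / (2 * pi) < 1"
    using measure_pos by simp_all
  then have "AE \<omega> in M. \<exists>n\<ge>1. Z n \<omega> \<in> accepted"
    using sets_accepted sets_rejected initial_law_unreachable shrinkage_kernel_rejected
    by (intro AE_reaches)
  then show ?thesis
    by eventually_elim (force simp: accepted_def)
qed

end

section \<open>Elliptical slice sampling\<close>

lemma hitting_time_less_infinity_iff:
  "hitting_time Z S \<omega> < \<infinity> \<longleftrightarrow> (\<exists>n\<ge>1. fst (Z n \<omega>) \<in> S)"
  unfolding hitting_time_def Inf_less_iff by force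

lemma shrinkage_chain_prob_hits:
  assumes chain: "shrinkage_chain \<theta> M Z" and S: "S \<in> sets borel"
    and T: "acceptance_interval \<theta> T" "T \<subseteq> S"
  shows "\<P>(\<omega> in M. hitting_time Z S \<omega> < \<infinity>) = 1"
proof -
  interpret markov_process M state_space initial_law "shrinkage_kernel \<theta>" Z
    using chain by unfold_locales (simp add: shrinkage_chain_def)
  have "AE \<omega> in M. \<exists>n\<ge>1. fst (Z n \<omega>) \<in> S"
    using acceptance_interval.shrinkage_chain_AE_enters[OF T(1) chain]
    by eventually_elim (use T(2) in blast)
  moreover have "{\<omega> \<in> space M. \<exists>n\<ge>1. fst (Z n \<omega>) \<in> S} \<in> events"
  proof -
    have "(fst :: real \<times> real \<times> real \<Rightarrow> real) \<in> borel_measurable state_space"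
      unfolding state_space_def borel_prod[symmetric]
      by (intro measurable_restrict_space1) simp
    then have "{\<omega> \<in> space M. fst (Z n \<omega>) \<in> S} \<in> events" if "1 \<le> n" for n
      using measurable_compose[OF measurable_state[OF that]] S by (intro predE pred_sets2)
    then show ?thesis
      by measurable
  qed
  ultimately show ?thesis
    unfolding hitting_time_less_infinity_iff by (subst prob_Collect_eq_1)
qed

lemma open_ellipse_vimage:
  fixes x w :: "'a::real_normed_vector"
  assumes "open A"
  shows "open (ellipse x w -` A)"
  using assms unfolding ellipse_def[abs_def] by (intro open_vimage continuous_intros)

lemma acceptance_interval_near_0:
  assumes "open U" and "0 \<in> U"
  obtains e where "acceptance_interval 0 {0..<e}" "{0..<e} \<subseteq> angles \<inter> U"
proof -
  obtain d where d: "0 < d" "ball 0 d \<subseteq> U"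
    using assms by (meson open_contains_ball)
  show ?thesis
  proof (rule that[of "min d (2 * pi)"])
    show "acceptance_interval 0 {0..<min d (2 * pi)}"
      using d(1) by unfold_locales (auto simp: angles_def is_interval_co)
    show "{0..<min d (2 * pi)} \<subseteq> angles \<inter> U"
      using d(2) by (force simp: angles_def)
  qed
qed

theorem corollary2p8:
  fixes \<rho> :: "'a::{real_inner, complete_space} \<Rightarrow> real"
    and x w :: 'a and t :: real
    and M :: "'b measure" and Z :: "nat \<Rightarrow> 'b \<Rightarrow> real \<times> real \<times> real"
  assumes "separable_space (euclidean :: 'a topology)"
    and "\<And>y. \<rho> y > 0"
    and "\<And>s. s \<ge> 0 \<Longrightarrow> open (level_set \<rho> s)"
    and "0 < t" and "t < \<rho> x"
    and "shrinkage_chain 0 M Z"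
  shows "measure M {\<omega> \<in> space M.
           hitting_time Z (ellipse_preimage x w (level_set \<rho> t)) \<omega> < \<infinity>} = 1"
proof -
  let ?U = "ellipse x w -` level_set \<rho> t"
  have preimage: "ellipse_preimage x w (level_set \<rho> t) = angles \<inter> ?U"
    by (auto simp: ellipse_preimage_def)
  have "open ?U"
    using assms(3)[of t] assms(4) by (intro open_ellipse_vimage) simp
  moreover have "0 \<in> ?U"
    using assms(5) by (simp add: ellipse_def level_set_def)
  ultimately obtain e where "acceptance_interval 0 {0..<e}" "{0..<e} \<subseteq> angles \<inter> ?U"
    by (rule acceptance_interval_near_0)
  moreover have "angles \<inter> ?U \<in> sets borel"
    using \<open>open ?U\<close> by (simp add: sets_angles)
  ultimately show ?thesis
    unfolding preimage using shrinkage_chain_prob_hits[OF assms(6)] by blast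
qed

end
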